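(* Let $n>1$ be an integer and let $q=3^n$. For every $a\in\mathbb{F}_{q}$, the ternary Kloosterman sum $\mathcal{K}_{q}(a)$ satisfies \[ \mathcal{K}_{q}(a)\equiv\begin{cases}0\pmod 9 & \text{if } \operatorname{Tr}(a)=0,\\ 3\pmod 9 & \text{if } \operatorname{Tr}(a)=1,\\ 6\pmod 9 & \text{if } \operatorname{Tr}(a)=2.\end{cases} \]
   Context: For $q=3^n$, $\operatorname{Tr}:\mathbb{F}_q\to\mathbb{F}_3$ is the absolute trace $\operatorname{Tr}(c)=c+c^3+c^{3^2}+\cdots+c^{3^{n-1}}$. With $\zeta$ a primitive cube root of unity, the ternary Kloosterman sum is \[\mathcal{K}_q(a)=\sum_{x\in\mathbb{F}_q}\zeta^{\operatorname{Tr}(x^{q-2}+ax)},\] where the sum includes $x=0$ (so $x^{q-2}=x^{-1}$ for $x\neq0$ and $0^{q-2}=0$). It is a rational integer, independent of the choice of $\zeta$. *)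

theory Defs
  imports Complex_Main "HOL-Library.Cardinality" "HOL-Number_Theory.Number_Theory"
begin

text \<open>
  The field with $3^n$ elements is a type \<open>'a :: {field, finite}\<close> with \<open>CARD('a) = 3 ^ n\<close>,
  and the field with three elements is its prime subfield \<open>{0, 1, 2}\<close>, so the absolute
  trace is a function from \<open>'a\<close> to itself.
\<close>

definition abs_trace :: "nat \<Rightarrow> 'a :: {field, finite} \<Rightarrow> 'a" where
  "abs_trace n c = (\<Sum>i<n. c ^ (3 ^ i))"

text \<open>
  The representative in \<open>{0, 1, 2}\<close> of an element of the prime subfield of a field of
  characteristic 3; it turns such an element into an exponent for a cube root of unity.
  Elements outside the prime subfield have no such representative, but values of the
  trace are always inside.
\<close>

definition F3_rep :: "'a :: {field, finite} \<Rightarrow> nat" where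
  "F3_rep y = (THE k. k < 3 \<and> of_nat k = y)"

definition primitive_unity_root :: "nat \<Rightarrow> complex \<Rightarrow> bool" where
  "primitive_unity_root k z \<longleftrightarrow> z ^ k = 1 \<and> (\<forall>j. 0 < j \<and> j < k \<longrightarrow> z ^ j \<noteq> 1)"

definition kloosterman :: "complex \<Rightarrow> nat \<Rightarrow> 'a :: {field, finite} \<Rightarrow> complex" where
  "kloosterman \<zeta> n a =
     (\<Sum>x\<in>UNIV. \<zeta> ^ F3_rep (abs_trace n (x ^ (3 ^ n - 2) + a * x)))"

end

theory Submission
  imports Defs "HOL-Computational_Algebra.Polynomial"
begin

text \<open>
  Write $q = 3^n$, and let $t(x) = \mathrm{Tr}(x^{-1} + ax)$ with the convention $0^{-1} = 0$.
  This is an odd function with values in the prime field, so it takes the values $1$ and $2$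
  equally often, say $N$ times each. Since $1 + \zeta + \zeta^2 = 0$, the Kloosterman sum is
  $(q - 2N) - N = q - 3N$ (lemma \<open>odd_F3_valued_sums\<close>). As $9$ divides $q$, its residue modulo $9$
  is determined by $N$ modulo $3$, and that residue can be read off inside the field itself.

  Indeed, $t(x)^2$ is $1$ or $0$ according to whether $t(x) \neq 0$, so that
  $\sum_x t(x)^2 = 2N = -N$ in the field. Expanding the square of
  $t(x) = \mathrm{Tr}(x^{-1}) + \mathrm{Tr}(ax)$ leaves three sums. After a substitution, each of
  the two sums of squares is $\sum_y \mathrm{Tr}(y)^2$ (or trivially zero),
  and this vanishes because $\mathrm{Tr}(y)^2$ is a combination of powers of $y$ with positive
  exponents below $q - 1$ (lemma \<open>sum_abs_trace_square\<close>). In the mixed sum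
  $\sum_x \mathrm{Tr}(x^{-1})\,\mathrm{Tr}(ax)$ only those terms survive in which the two
  Frobenius powers agree, and they add up to $-\mathrm{Tr}(a)$
  (lemma \<open>sum_abs_trace_inverse_mult\<close>). Hence $-N = -2\,\mathrm{Tr}(a)$, that is,
  $N \equiv -\mathrm{Tr}(a) \pmod 3$, and $q - 3N \equiv 3\,\mathrm{Tr}(a) \pmod 9$.
\<close>

section \<open>Power sums over a finite field\<close>

text \<open>
  Multiplication by $x$ permutes the nonzero elements, so it preserves their product.
\<close>
lemma finite_field_power_card_minus_one:
  fixes x :: "'a :: {field, finite}"
  assumes "x \<noteq> 0"
  shows "x ^ (CARD('a) - 1) = 1"
proof -
  have "(\<Prod>y\<in>UNIV-{0}. y) = (\<Prod>y\<in>UNIV-{0}. x * y)"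
    by (rule prod.reindex_bij_witness[of _ "\<lambda>y. x * y" "\<lambda>y. y / x"]) (use assms in auto)
  also have "\<dots> = x ^ (CARD('a) - 1) * (\<Prod>y\<in>UNIV-{0}. y)"
    by (simp add: prod.distrib)
  finally show ?thesis
    by simp
qed

lemma finite_field_power_card:
  fixes x :: "'a :: {field, finite}"
  shows "x ^ CARD('a) = x"
proof (cases "x = 0")
  case False
  have "x ^ Suc (CARD('a) - 1) = x"
    unfolding power_Suc finite_field_power_card_minus_one[OF False] by simp
  moreover have "Suc (CARD('a) - 1) = CARD('a)"
    by (simp add: card_gt_0_iff)
  ultimately show ?thesis
    by metis
qed simp

lemma finite_field_power_card_minus_two:
  fixes x :: "'a :: {field, finite}"
  assumes "CARD('a) > 2"
  shows "x ^ (CARD('a) - 2) = inverse x"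
proof (cases "x = 0")
  case False
  have "Suc (CARD('a) - 2) = CARD('a) - 1"
    using assms by simp
  hence "x * x ^ (CARD('a) - 2) = 1"
    using finite_field_power_card_minus_one[OF False] by (metis power_Suc)
  thus ?thesis
    by (metis inverse_unique)
qed (use assms in simp)

text \<open>
  Two monomials of distinct degrees below the size of the field cannot agree everywhere: their
  difference would have more roots than its degree. Since both exponents are positive, they agree
  at zero, so a point of disagreement is a unit.
\<close>
lemma ex_power_neq:
  fixes A B :: nat
  assumes "0 < A" "0 < B" "A \<noteq> B" "A < CARD('a)" "B < CARD('a)"
  shows "\<exists>g :: 'a :: {field, finite}. g \<noteq> 0 \<and> g ^ A \<noteq> g ^ B"
proof (rule ccontr)
  assume "\<not> ?thesis"
  hence "x ^ A = x ^ B" for x :: 'a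
    using assms by (cases "x = 0") (auto simp: power_0_left)
  hence "Polynomial.monom (1 :: 'a) A = Polynomial.monom 1 B"
    using assms by (intro poly_eqI_degree[of "UNIV"]) (auto simp: poly_monom Polynomial.degree_monom_eq)
  thus False
    using \<open>A \<noteq> B\<close> by (metis Polynomial.degree_monom_eq one_neq_zero)
qed

text \<open>
  The orthogonality argument behind every vanishing power sum below: scaling by $g$ permutes the
  field, so the sum equals $c$ times itself.
\<close>
lemma sum_eq_0_if_semi_invariant:
  fixes f :: "'a :: {field, finite} \<Rightarrow> 'a"
  assumes "g \<noteq> 0" "c \<noteq> 1" "\<And>x. f (g * x) = c * f x"
  shows "(\<Sum>x\<in>UNIV. f x) = 0"
proof -
  have "(\<Sum>x\<in>UNIV. f x) = (\<Sum>x\<in>UNIV. f (g * x))"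
    by (rule sum.reindex_bij_witness[of _ "\<lambda>x. g * x" "\<lambda>x. x / g"]) (use assms(1) in auto)
  also have "\<dots> = c * (\<Sum>x\<in>UNIV. f x)"
    by (simp add: assms(3) sum_distrib_left)
  finally show ?thesis
    using assms(2) by simp
qed

section \<open>The trace to the field with three elements\<close>

lemma CHAR_eq_3:
  assumes "CARD('a :: {field, finite}) = 3 ^ n"
  shows "CHAR('a) = 3"
proof -
  have "prime CHAR('a)"
    using finite_imp_CHAR_pos[where ?'a = 'a] prime_CHAR_semidom[where ?'a = 'a] by simp
  moreover have "CHAR('a) dvd 3 ^ n"
    using CHAR_dvd_CARD[where ?'a = 'a] assms by simp
  ultimately have "CHAR('a) dvd 3"
    using prime_dvd_power by blast
  thus ?thesis
    using \<open>prime CHAR('a)\<close> by (simp add: primes_dvd_imp_eq)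
qed

lemma abs_trace_add:
  fixes x y :: "'a :: {field, finite}"
  assumes "CARD('a) = 3 ^ n"
  shows "abs_trace m (x + y) = abs_trace m x + abs_trace m y"
proof -
  have "(x + y) ^ (3 ^ i) = x ^ (3 ^ i) + y ^ (3 ^ i)" for i
    by (rule freshmans_dream') (simp_all add: CHAR_eq_3[OF assms])
  thus ?thesis
    by (simp add: abs_trace_def sum.distrib)
qed

lemma abs_trace_minus: "abs_trace n (- x) = - abs_trace n x"
  by (simp add: abs_trace_def power_minus_odd sum_negf)

text \<open>
  Frobenius shifts the summands of the trace cyclically. Being fixed by it, the trace is a root
  of $X^3 - X = X (X - 1) (X + 1)$.
\<close>
lemma abs_trace_cube:
  fixes x :: "'a :: {field, finite}"
  assumes "CARD('a) = 3 ^ n"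
  shows "abs_trace n x ^ 3 = abs_trace n x"
proof -
  have "abs_trace n x ^ 3 = (\<Sum>i<n. (x ^ 3 ^ i) ^ 3)"
    unfolding abs_trace_def by (rule freshmans_dream_sum) (simp_all add: CHAR_eq_3[OF assms])
  also have "\<dots> = (\<Sum>i<n. x ^ 3 ^ Suc i)"
    by (simp flip: power_mult add: mult.commute)
  also have "\<dots> = (\<Sum>i<n. x ^ 3 ^ i)"
    using sum.lessThan_Suc_shift[of "\<lambda>i. x ^ 3 ^ i" n] finite_field_power_card[of x] assms
    by simp
  finally show ?thesis
    by (simp add: abs_trace_def)
qed

lemma abs_trace_cases:
  fixes x :: "'a :: {field, finite}"
  assumes "CARD('a) = 3 ^ n"
  shows "abs_trace n x = 0 \<or> abs_trace n x = 1 \<or> abs_trace n x = -1"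
proof -
  let ?t = "abs_trace n x"
  have "?t * (?t - 1) * (?t + 1) = ?t ^ 3 - ?t"
    by (simp add: algebra_simps power3_eq_cube)
  hence "?t * (?t - 1) * (?t + 1) = 0"
    using abs_trace_cube[OF assms, of x] by simp
  thus ?thesis
    by (auto simp: eq_neg_iff_add_eq_0)
qed

lemma F3_rep_of_nat:
  assumes "CHAR('a :: {field, finite}) = 3" "k < 3"
  shows "F3_rep (of_nat k :: 'a) = k"
  unfolding F3_rep_def
  by (rule the_equality) (use assms in \<open>auto simp: of_nat_eq_iff_cong_CHAR cong_def\<close>)

section \<open>Odd functions with values in the prime field\<close>

text \<open>
  By oddness, the number $N$ of solutions of $t(x) = 1$ is also that of $t(x) = -1$, so these two
  sums, one complex and one in the field, depend only on the same integer $N$. This is what lets a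
  computation in characteristic 3 control the complex character sum.
\<close>
lemma odd_F3_valued_sums:
  fixes t :: "'a \<Rightarrow> 'a :: {field, finite}" and \<zeta> :: complex
  assumes "CARD('a) = 3 ^ n" "primitive_unity_root 3 \<zeta>"
    and odd: "\<And>x. t (- x) = - t x"
    and vals: "\<And>x. t x = 0 \<or> t x = 1 \<or> t x = -1"
  defines "N \<equiv> card {x. t x = 1}"
  shows "(\<Sum>x\<in>UNIV. \<zeta> ^ F3_rep (t x)) = of_nat CARD('a) - 3 * of_nat N"
    and "(\<Sum>x\<in>UNIV. (t x)\<^sup>2) = - of_nat N"
proof -
  note CH = CHAR_eq_3[OF assms(1)]
  have three: "(3 :: 'a) = 0"
    using of_nat_CHAR[where ?'a = 'a] CH by simp
  have neg1: "(-1 :: 'a) = of_nat 2"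
    using three by (simp add: neg_eq_iff_add_eq_0)
  have "of_nat 2 \<noteq> (0 :: 'a)"
    unfolding of_nat_eq_0_iff_char_dvd CH by simp
  hence ne: "(1 :: 'a) \<noteq> -1" "(-1 :: 'a) \<noteq> 1"
    by (simp_all add: eq_neg_iff_add_eq_0 neg_eq_iff_add_eq_0)
  have reps: "F3_rep (0 :: 'a) = 0" "F3_rep (1 :: 'a) = 1" "F3_rep (-1 :: 'a) = 2"
    using F3_rep_of_nat[OF CH, of 0] F3_rep_of_nat[OF CH, of 1] F3_rep_of_nat[OF CH, of 2]
    unfolding neg1 by simp_all
  have N': "card {x. t x = -1} = N"
    unfolding N_def
    by (rule bij_betw_same_card[of uminus], rule bij_betwI[where g = uminus]) (auto simp: odd)
  have ind: "(\<Sum>x\<in>UNIV. if P x then c else 0) = of_nat (card {x. P x}) * c"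
    for P :: "'a \<Rightarrow> bool" and c :: "'c :: comm_ring_1"
    by (simp add: sum.If_cases)
  have z: "1 + \<zeta> + \<zeta>\<^sup>2 = 0"
  proof -
    have "\<zeta> ^ 3 = 1" "\<zeta> ^ 1 \<noteq> 1"
      using assms(2) unfolding primitive_unity_root_def by (blast, force)
    moreover have "(\<zeta> - 1) * (1 + \<zeta> + \<zeta>\<^sup>2) = \<zeta> ^ 3 - 1"
      by (simp add: algebra_simps power2_eq_square power3_eq_cube)
    ultimately show ?thesis
      by simp
  qed
  \<comment> \<open>Compare with the constant 1, which contributes the number of elements of the field.\<close>
  have "\<zeta> ^ F3_rep (t x) =
      1 + (if t x = 1 then \<zeta> - 1 else 0) + (if t x = -1 then \<zeta>\<^sup>2 - 1 else 0)" for x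
    using vals[of x] reps ne by auto
  hence "(\<Sum>x\<in>UNIV. \<zeta> ^ F3_rep (t x)) =
      of_nat CARD('a) + of_nat N * (\<zeta> - 1) + of_nat N * (\<zeta>\<^sup>2 - 1)"
    by (simp add: sum.distrib ind N' N_def)
  also have "\<dots> = of_nat CARD('a) + of_nat N * (1 + \<zeta> + \<zeta>\<^sup>2) - 3 * of_nat N"
    by (simp add: algebra_simps)
  finally show "(\<Sum>x\<in>UNIV. \<zeta> ^ F3_rep (t x)) = of_nat CARD('a) - 3 * of_nat N"
    using z by simp
  have "(t x)\<^sup>2 = (if t x = 1 then 1 else 0) + (if t x = -1 then 1 else 0)" for x
    using vals[of x] ne by auto
  hence "(\<Sum>x\<in>UNIV. (t x)\<^sup>2) = of_nat N + of_nat N"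
    by (simp add: sum.distrib ind N' flip: N_def)
  also have "\<dots> = 3 * of_nat N - of_nat N"
    by simp
  finally show "(\<Sum>x\<in>UNIV. (t x)\<^sup>2) = - of_nat N"
    using three by simp
qed

section \<open>Correlations of traces\<close>

lemma sum_abs_trace_mult:
  fixes f g :: "'b \<Rightarrow> 'a :: {field, finite}"
  shows "(\<Sum>x\<in>S. abs_trace n (f x) * abs_trace n (g x)) =
    (\<Sum>i<n. \<Sum>j<n. \<Sum>x\<in>S. f x ^ (3 ^ i) * g x ^ (3 ^ j))"
proof -
  have "(\<Sum>x\<in>S. abs_trace n (f x) * abs_trace n (g x)) =
      (\<Sum>x\<in>S. \<Sum>i<n. \<Sum>j<n. f x ^ (3 ^ i) * g x ^ (3 ^ j))"
    by (simp add: abs_trace_def sum_product)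
  also have "\<dots> = (\<Sum>i<n. \<Sum>x\<in>S. \<Sum>j<n. f x ^ (3 ^ i) * g x ^ (3 ^ j))"
    by (rule sum.swap)
  also have "\<dots> = (\<Sum>i<n. \<Sum>j<n. \<Sum>x\<in>S. f x ^ (3 ^ i) * g x ^ (3 ^ j))"
    by (intro sum.cong refl sum.swap)
  finally show ?thesis .
qed

text \<open>
  The square of the trace expands into monomials of degree $3^i + 3^j \le 2 \cdot 3^{n-1}$. This is
  less than $3^n - 1$ exactly when $n > 1$; for $n = 1$ the sum is $0 + 1 + 1 = -1$.
\<close>
lemma sum_abs_trace_square:
  assumes "n > 1" "CARD('a :: {field, finite}) = 3 ^ n"
  shows "(\<Sum>x\<in>(UNIV :: 'a set). (abs_trace n x)\<^sup>2) = 0"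
proof -
  have "(\<Sum>x\<in>UNIV. x ^ (3 ^ i) * x ^ (3 ^ j)) = (0 :: 'a)" if "i < n" "j < n" for i j
  proof -
    obtain m where m: "n = Suc m" "m > 0"
      using assms(1) by (cases n) auto
    have "(3 :: nat) ^ i \<le> 3 ^ m" "(3 :: nat) ^ j \<le> 3 ^ m"
      using that m by (auto intro!: power_increasing)
    moreover have "(3 :: nat) \<le> 3 ^ m"
      using m self_le_power[of "3 :: nat" m] by simp
    moreover have "CARD('a) = 3 * 3 ^ m"
      using m assms(2) by simp
    ultimately have "1 + (3 ^ i + 3 ^ j) < CARD('a)"
      by linarith
    \<comment> \<open>The exponents are raised by one so that both are positive.\<close>
    then obtain g :: 'a where g: "g \<noteq> 0" "g ^ 1 \<noteq> g ^ (1 + (3 ^ i + 3 ^ j))"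
      using ex_power_neq[of 1 "1 + (3 ^ i + 3 ^ j)", where ?'a = 'a] by auto
    hence "g ^ (3 ^ i + 3 ^ j) \<noteq> 1"
      by auto
    with g(1) show ?thesis
      by (rule sum_eq_0_if_semi_invariant) (simp add: power_add power_mult_distrib mult_ac)
  qed
  thus ?thesis
    by (simp add: power2_eq_square sum_abs_trace_mult[where f = "\<lambda>x. x" and g = "\<lambda>x. x"])
qed

text \<open>
  Among the products of a Frobenius power of $x^{-1}$ and one of $x$, scaling $x$ by a suitable unit
  kills all but those with equal exponents. These are constantly $1$ on the $q - 1$ units, so
  each contributes $q - 1 = -1$.
\<close>
lemma sum_abs_trace_inverse_mult:
  fixes a :: "'a :: {field, finite}"
  assumes "CARD('a) = 3 ^ n"
  shows "(\<Sum>x\<in>UNIV. abs_trace n (inverse x) * abs_trace n (a * x)) = - abs_trace n a"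
proof -
  have orth: "(\<Sum>x\<in>UNIV. inverse x ^ (3 ^ i) * x ^ (3 ^ j)) = (if i = j then - 1 else 0 :: 'a)"
    if "i < n" "j < n" for i j
  proof (cases "i = j")
    case True
    have "inverse x ^ (3 ^ i) * x ^ (3 ^ j) = 1 - (if x = 0 then 1 else 0)" for x :: 'a
      using True by (simp flip: power_mult_distrib)
    hence "(\<Sum>x\<in>UNIV. inverse x ^ (3 ^ i) * x ^ (3 ^ j)) = of_nat CARD('a) - (1 :: 'a)"
      by (simp only: sum_subtractf) simp
    also have "of_nat CARD('a) = (0 :: 'a)"
      using CHAR_dvd_CARD[where ?'a = 'a] by (simp only: of_nat_eq_0_iff_char_dvd)
    finally show ?thesis
      using True by simp
  next
    case False
    have "(3 :: nat) ^ i < CARD('a)" "(3 :: nat) ^ j < CARD('a)"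
      using that assms by simp_all
    then obtain g :: 'a where g: "g \<noteq> 0" "g ^ (3 ^ i) \<noteq> g ^ (3 ^ j)"
      using ex_power_neq[of "3 ^ i" "3 ^ j", where ?'a = 'a] False by auto
    have "inverse g ^ (3 ^ i) * g ^ (3 ^ j) \<noteq> 1"
      using g by (auto simp: power_inverse field_simps)
    with g(1) have "(\<Sum>x\<in>UNIV. inverse x ^ (3 ^ i) * x ^ (3 ^ j)) = (0 :: 'a)"
      by (rule sum_eq_0_if_semi_invariant) (simp add: power_mult_distrib mult_ac)
    thus ?thesis
      using False by simp
  qed
  have "(\<Sum>x\<in>UNIV. abs_trace n (inverse x) * abs_trace n (a * x)) =
      (\<Sum>i<n. \<Sum>j<n. \<Sum>x\<in>UNIV. inverse x ^ (3 ^ i) * (a * x) ^ (3 ^ j))"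
    by (rule sum_abs_trace_mult)
  also have "\<dots> = (\<Sum>i<n. \<Sum>j<n. a ^ (3 ^ j) * (\<Sum>x\<in>UNIV. inverse x ^ (3 ^ i) * x ^ (3 ^ j)))"
    by (simp only: sum_distrib_left power_mult_distrib mult_ac)
  also have "\<dots> = (\<Sum>i<n. \<Sum>j<n. if i = j then - (a ^ (3 ^ j)) else 0)"
    by (intro sum.cong refl) (auto simp: orth)
  also have "\<dots> = - abs_trace n a"
    by (simp add: abs_trace_def sum_negf)
  finally show ?thesis .
qed

section \<open>The congruence\<close>

theorem theorem2:
  fixes n :: nat and \<zeta> :: complex and a :: "'a :: {field, finite}"
  assumes "n > 1"
    and "CARD('a) = 3 ^ n"
    and "primitive_unity_root 3 \<zeta>"
  shows "\<exists>k :: int. kloosterman \<zeta> n a = of_int k \<and>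
           (abs_trace n a = 0 \<longrightarrow> [k = 0] (mod 9)) \<and>
           (abs_trace n a = 1 \<longrightarrow> [k = 3] (mod 9)) \<and>
           (abs_trace n a = 2 \<longrightarrow> [k = 6] (mod 9))"
proof -
  define u where "u = (\<lambda>x :: 'a. abs_trace n (inverse x))"
  define v where "v = (\<lambda>x :: 'a. abs_trace n (a * x))"
  define t where "t = (\<lambda>x :: 'a. abs_trace n (inverse x + a * x))"
  define N where "N = card {x. t x = 1}"
  note CH = CHAR_eq_3[OF assms(2)]
  have three: "(3 :: 'a) = 0"
    using of_nat_CHAR[where ?'a = 'a] CH by simp
  define m where "m = n - 2"
  have "n = Suc (Suc m)"
    using assms(1) by (simp add: m_def)
  hence q: "CARD('a) = 9 * 3 ^ m"
    using assms(2) by simp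
  have t_odd: "t (- x) = - t x" for x
    by (simp add: t_def flip: abs_trace_minus)
  have t_vals: "t x = 0 \<or> t x = 1 \<or> t x = -1" for x
    unfolding t_def by (rule abs_trace_cases[OF assms(2)])
  note sums = odd_F3_valued_sums[where t = t, OF assms(2,3) t_odd t_vals, folded N_def]
  have u2: "(\<Sum>x\<in>UNIV. (u x)\<^sup>2) = 0"
  proof -
    have "(\<Sum>x\<in>UNIV. (u x)\<^sup>2) = (\<Sum>x\<in>(UNIV :: 'a set). (abs_trace n x)\<^sup>2)"
      by (rule sum.reindex_bij_witness[of _ inverse inverse])
         (auto simp: u_def)
    thus ?thesis
      using sum_abs_trace_square[OF assms(1,2)] by simp
  qed
  have v2: "(\<Sum>x\<in>UNIV. (v x)\<^sup>2) = 0"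
  proof (cases "a = 0")
    case False
    have "(\<Sum>x\<in>UNIV. (v x)\<^sup>2) = (\<Sum>x\<in>(UNIV :: 'a set). (abs_trace n x)\<^sup>2)"
      by (rule sum.reindex_bij_witness[of _ "\<lambda>x. x / a" "\<lambda>x. a * x"])
         (use False in \<open>auto simp: v_def\<close>)
    thus ?thesis
      using sum_abs_trace_square[OF assms(1,2)] by simp
  qed (simp add: v_def abs_trace_def power_0_left)
  have "- of_nat N = (\<Sum>x\<in>UNIV. (u x)\<^sup>2 + (v x)\<^sup>2 + 2 * (u x * v x))"
    unfolding sums(2)[symmetric]
    by (simp add: t_def u_def v_def abs_trace_add[OF assms(2)] power2_sum mult.assoc)
  also have "\<dots> = 2 * (\<Sum>x\<in>UNIV. u x * v x)"
    by (simp add: sum.distrib u2 v2 flip: sum_distrib_left)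
  also have "\<dots> = - (2 * abs_trace n a)"
    using sum_abs_trace_inverse_mult[OF assms(2), of a] by (simp add: u_def v_def)
  finally have N: "of_nat N = 2 * abs_trace n a"
    by simp
  have mod3: "[N = r] (mod 3)" if "of_nat N = (of_nat r :: 'a)" for r
    using that by (simp add: of_nat_eq_iff_cong_CHAR CH)
  have mod9: "[9 * 3 ^ m - 3 * int N = s] (mod 9)" if "9 dvd 3 * int N + s" for s
  proof -
    have "9 * 3 ^ m - 3 * int N - s = 9 * 3 ^ m - (3 * int N + s)"
      by simp
    thus ?thesis
      unfolding cong_iff_dvd_diff by (simp only: dvd_diff[OF dvd_triv_left that])
  qed
  show ?thesis
  proof (intro exI[of _ "9 * 3 ^ m - 3 * int N"] conjI impI)
    show "kloosterman \<zeta> n a = of_int (9 * 3 ^ m - 3 * int N)"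
    proof -
      have "(3 :: nat) ^ m > 0"
        by simp
      hence "CARD('a) > 2"
        unfolding q by linarith
      hence "x ^ (3 ^ n - 2) = inverse x" for x :: 'a
        unfolding assms(2)[symmetric] by (rule finite_field_power_card_minus_two)
      thus ?thesis
        using sums(1) by (simp add: kloosterman_def t_def q)
    qed
  next
    assume "abs_trace n a = 0"
    hence "[N = 0] (mod 3)"
      by (intro mod3) (simp add: N)
    hence "9 dvd 3 * int N + 0"
      by (simp add: cong_def) presburger
    thus "[9 * 3 ^ m - 3 * int N = 0] (mod 9)"
      by (rule mod9)
  next
    assume "abs_trace n a = 1"
    hence "[N = 2] (mod 3)"
      by (intro mod3) (simp add: N)
    hence "9 dvd 3 * int N + 3"
      by (simp add: cong_def) presburger
    thus "[9 * 3 ^ m - 3 * int N = 3] (mod 9)"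
      by (rule mod9)
  next
    assume "abs_trace n a = 2"
    hence "of_nat N = (3 + 1 :: 'a)"
      by (simp add: N)
    hence "[N = 1] (mod 3)"
      unfolding three by (intro mod3) simp
    hence "9 dvd 3 * int N + 6"
      by (simp add: cong_def) presburger
    thus "[9 * 3 ^ m - 3 * int N = 6] (mod 9)"
      by (rule mod9)
  qed
qed

end
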